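(* Let $n\ge 1$ and let $G$ be a finitely generated abelian sub-semigroup of $\mathbb{T}_n(\mathbb{C})$, generated by $A_1,\dots,A_p$ ($p\geq 1$). If there exists a basis $(e'_1,\dots,e'_n)$ of $\mathbb{C}^n$ such that $J_G(e'_k)=\mathbb{C}^n$ for every $k=1,\dots,n$, then $G$ is hypercyclic.
   Context: $\mathbb{T}_n(\mathbb{C})$ is the set of $n\times n$ complex lower triangular matrices whose diagonal entries are all equal. $\mathbb{N}$ contains $0$. The abelian semigroup $G$ generated by pairwise commuting matrices $A_1,\dots,A_p$ is the set of products $A_1^{k_1}\cdots A_p^{k_p}$ with $k_j$ non-negative integers. The orbit of $v\in\mathbb{C}^n$ is $G(v)=\{Av: A\in G\}$. $G$ is hypercyclic if there exists $v\in\mathbb{C}^n$ with $G(v)$ dense in $\mathbb{C}^n$. Extended limit set: for $x\in\mathbb{C}^n$, $J_G(x)$ is the set of $y\in\mathbb{C}^n$ for which there exist a sequence $(x_m)_m\subset\mathbb{C}^n$ and sequences of non-negative integers $(k_m^{(j)})_m$, $j=1,\dots,p$, with $k_m^{(1)}+\dots+k_m^{(p)}\to+\infty$, such that $x_m\to x$ and $A_1^{k_m^{(1)}}\cdots A_p^{k_m^{(p)}}x_m\to y$. *)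

theory Defs
  imports "HOL-Analysis.Analysis"
begin

text \<open>
  The dimension $n$ is \<open>CARD('n)\<close> for a finite linearly ordered index type \<open>'n\<close>; the order of
  \<open>'n\<close> plays the role of the order of the indices $1, \dots, n$. The entry in row \<open>i\<close> and
  column \<open>j\<close> of \<open>A\<close> is \<open>A $ i $ j\<close>.
\<close>

definition lower_tri_eq_diag :: "((complex, 'n::{finite,linorder}) vec, 'n) vec set"
  where "lower_tri_eq_diag =
    {A. (\<forall>i j. i < j \<longrightarrow> A $ i $ j = 0) \<and> (\<forall>i j. A $ i $ i = A $ j $ j)}"

text \<open>
  The operations \<open>*\<close> and \<open>^\<close> of the type class instances on \<open>_ ^ 'n ^ 'n\<close> act componentwise, so
  powers for the matrix product \<open>**\<close> are introduced separately.
\<close>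

primrec mat_power :: "'a::semiring_1 ^ 'n ^ 'n \<Rightarrow> nat \<Rightarrow> 'a ^ 'n ^ 'n"
  where
    "mat_power A 0 = mat 1"
  | "mat_power A (Suc k) = A ** mat_power A k"

text \<open>$A_1^{k_1} \cdots A_p^{k_p}$\<close>

primrec power_prod ::
    "(nat \<Rightarrow> 'a::semiring_1 ^ 'n ^ 'n) \<Rightarrow> nat \<Rightarrow> (nat \<Rightarrow> nat) \<Rightarrow> 'a ^ 'n ^ 'n"
  where
    "power_prod A 0 k = mat 1"
  | "power_prod A (Suc p) k = power_prod A p k ** mat_power (A (Suc p)) (k (Suc p))"

text \<open>
  Exponents may be $0$, so this set contains the identity matrix. It is a semigroup
  only when \<open>A 1, \<dots>, A p\<close> commute pairwise.
\<close>

definition generated_semigroup ::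
    "(nat \<Rightarrow> 'a::semiring_1 ^ 'n ^ 'n) \<Rightarrow> nat \<Rightarrow> ('a ^ 'n ^ 'n) set"
  where "generated_semigroup A p = range (power_prod A p)"

definition orbit :: "(complex ^ 'n ^ 'n) set \<Rightarrow> complex ^ 'n \<Rightarrow> (complex ^ 'n) set"
  where "orbit G v = (\<lambda>B. B *v v) ` G"

definition hypercyclic :: "(complex ^ 'n ^ 'n) set \<Rightarrow> bool"
  where "hypercyclic G \<longleftrightarrow> (\<exists>v. closure (orbit G v) = UNIV)"

text \<open>
  The set depends on the generators \<open>A 1, \<dots>, A p\<close>, since the condition that the sum of
  the exponents tends to infinity does.
\<close>

definition extended_limit_set ::
    "(nat \<Rightarrow> complex ^ 'n ^ 'n) \<Rightarrow> nat \<Rightarrow> complex ^ 'n \<Rightarrow> (complex ^ 'n) set"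
  where "extended_limit_set A p x =
    {y. \<exists>(xs :: nat \<Rightarrow> complex ^ 'n) (k :: nat \<Rightarrow> nat \<Rightarrow> nat).
          filterlim (\<lambda>m. \<Sum>j=1..p. k m j) at_top sequentially \<and>
          xs \<longlonglongrightarrow> x \<and>
          (\<lambda>m. power_prod A p (k m) *v xs m) \<longlonglongrightarrow> y}"

text \<open>
  \<open>vec.independent\<close> and \<open>vec.span\<close> refer to the scalar multiplication \<open>*s\<close>, so they
  are taken over the complex numbers; \<open>independent\<close> and \<open>span\<close> would be over the reals.
\<close>

definition complex_basis :: "('n \<Rightarrow> complex ^ 'n) \<Rightarrow> bool"
  where "complex_basis e \<longleftrightarrow>
    inj e \<and> vec.independent (range e) \<and> vec.span (range e) = UNIV"

end

theory Submission
  imports Defs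
begin

text \<open>
  Some basis vector $u$ has nonzero first coordinate. Let $C$ be the commutant of the generators;
  $Cu$ is an invariant subspace. If it were proper, its annihilator would contain a common left
  eigenvector $a$, and since all diagonal entries of $B \in G$ equal the same $\mu_B$, both $a$ and
  the first coordinate would be multiplied by $\mu_B$. Along $B_m x_m \to y$ with $x_m \to u$ the
  first coordinate forces $\mu_{B_m}$ to converge, so $a \cdot y = \lim \mu_{B_m} a \cdot x_m = 0$
  for every $y \in J_G(u) = \mathbb{C}^n$, which is absurd. Hence $Cu = \mathbb{C}^n$, and one can
  write $x_m = T_m u$ with $T_m \in C$ and $T_m \to I$. Then $B_m x_m = T_m B_m u$, so
  $B_m u \to y$ as well and $G(u)$ is dense.
\<close>

section \<open>Complex-bilinear pairing and annihilators\<close>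

text \<open>Without conjugation the pairing is complex linear in both arguments, and the adjoint of
  \<open>A *v\<close> is \<open>v* A\<close>; thus row vectors serve as functionals.\<close>

definition bilin_dot :: "'a::comm_ring_1 ^ 'n \<Rightarrow> 'a ^ 'n \<Rightarrow> 'a"
  where "bilin_dot a x = (\<Sum>i\<in>UNIV. a $ i * x $ i)"

lemma bilin_dot_matrix: "bilin_dot a (A *v x) = bilin_dot (a v* A) x"
proof -
  have "bilin_dot a (A *v x) = (\<Sum>i\<in>UNIV. \<Sum>j\<in>UNIV. a $ i * (A $ i $ j * x $ j))"
    by (simp add: bilin_dot_def matrix_vector_mult_def sum_distrib_left)
  also have "\<dots> = (\<Sum>j\<in>UNIV. \<Sum>i\<in>UNIV. a $ i * (A $ i $ j * x $ j))"
    by (rule sum.swap)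
  also have "\<dots> = bilin_dot (a v* A) x"
    by (simp add: bilin_dot_def vector_matrix_mult_def sum_distrib_left sum_distrib_right mult_ac)
  finally show ?thesis .
qed

lemma bilin_dot_scale: "bilin_dot (c *s a) x = c * bilin_dot a x"
  by (simp add: bilin_dot_def sum_distrib_left mult.assoc)

lemma tendsto_bilin_dot:
  fixes x :: "'b \<Rightarrow> complex ^ 'n"
  shows "(x \<longlongrightarrow> l) F \<Longrightarrow> ((\<lambda>m. bilin_dot a (x m)) \<longlongrightarrow> bilin_dot a l) F"
  unfolding bilin_dot_def by (intro tendsto_intros)

lemma bilin_dot_nondegenerate:
  fixes a :: "'a::comm_ring_1 ^ 'n"
  assumes "\<And>x. bilin_dot a x = 0"
  shows "a = 0"
proof (rule vec_eq_iff[THEN iffD2], intro allI)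
  fix i
  have "bilin_dot a (axis i 1) = a $ i"
    by (simp add: bilin_dot_def axis_def if_distrib[of "\<lambda>c. _ * c"] cong: if_cong)
  with assms show "a $ i = 0 $ i" by simp
qed

text \<open>A vector orthogonal to \<open>E\<close> for the real inner product gives a pairing whose
  real part vanishes on \<open>E\<close>. Closure of \<open>E\<close> under multiplication by the
  imaginary unit then removes the imaginary part too.\<close>

lemma proper_subspace_annihilator:
  fixes E :: "(complex ^ 'n) set"
  assumes E: "vec.subspace E" and "E \<noteq> UNIV"
  shows "\<exists>a. a \<noteq> 0 \<and> (\<forall>x\<in>E. bilin_dot a x = 0)"
proof -
  have scaleR: "r *\<^sub>R x = of_real r *s x" for r and x :: "complex ^ 'n"
    by (simp add: vec_eq_iff scaleR_conv_of_real[of r "_ :: complex"])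
  have sub: "subspace E"
    using E unfolding subspace_def vec.subspace_def scaleR by blast
  hence "span E \<noteq> UNIV" using \<open>E \<noteq> UNIV\<close> by (simp add: span_eq_iff[THEN iffD2])
  hence "span E \<subset> UNIV" by blast
  then obtain b where b: "b \<noteq> 0" "\<And>x. x \<in> span E \<Longrightarrow> orthogonal b x"
    using orthogonal_to_subspace_exists_gen[of E UNIV] by (metis span_UNIV)
  \<comment> \<open>The conjugation turns the real inner product with \<open>b\<close> into the real
    part of the pairing with \<open>a\<close>.\<close>
  define a where "a = (\<chi> i. cnj (b $ i))"
  have Re_dot: "Re (bilin_dot a x) = b \<bullet> x" for x
    by (simp add: bilin_dot_def a_def inner_vec_def inner_complex_def)
  have Re0: "Re (bilin_dot a x) = 0" if "x \<in> E" for x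
    using b(2) span_base[OF that] by (simp add: Re_dot orthogonal_def)
  show ?thesis
  proof (intro exI conjI ballI)
    show "a \<noteq> 0" using b(1) by (auto simp: a_def vec_eq_iff)
    fix x assume x: "x \<in> E"
    have "bilin_dot a (\<i> *s x) = \<i> * bilin_dot a x"
      by (simp add: bilin_dot_def sum_distrib_left mult_ac)
    moreover have "\<i> *s x \<in> E" using E x by (simp add: vec.subspace_def)
    ultimately have "Im (bilin_dot a x) = 0" using Re0[of "\<i> *s x"] by simp
    with Re0[OF x] show "bilin_dot a x = 0" by (simp add: complex_eq_iff)
  qed
qed

section \<open>Common left eigenvectors of triangular matrices\<close>

lemma common_left_eigenvector:
  fixes W :: "(complex, 'n::{finite,linorder}) vec set"
  assumes W: "vec.subspace W" and "W \<noteq> {0}"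
    and S: "S \<subseteq> lower_tri_eq_diag"
    and inv: "\<And>A a. A \<in> S \<Longrightarrow> a \<in> W \<Longrightarrow> a v* A \<in> W"
  shows "\<exists>a\<in>W. a \<noteq> 0 \<and> (\<forall>A\<in>S. \<forall>i. a v* A = A $ i $ i *s a)"
proof -
  define supp where "supp a = {i. a $ i \<noteq> 0}" for a :: "(complex, 'n) vec"
  have supp: "finite (supp a)" "a \<noteq> 0 \<Longrightarrow> supp a \<noteq> {}" for a
    by (auto simp: supp_def vec_eq_iff)
  txt \<open>
    Acting on rows, the nilpotent part of a matrix in \<open>S\<close> lowers the largest index of the support,
    so it kills every \<open>a\<close> that minimises this index.
  \<close>
  define M where "M = Min ((\<lambda>a. Max (supp a)) ` (W - {0}))"
  have "0 \<in> W" using W by (rule vec.subspace_0)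
  hence ne: "(\<lambda>a. Max (supp a)) ` (W - {0}) \<noteq> {}" using \<open>W \<noteq> {0}\<close> by blast
  have fin: "finite ((\<lambda>a. Max (supp a)) ` (W - {0}))" by simp
  obtain a where "a \<in> W - {0}" and M: "M = Max (supp a)"
    using Min_in[OF fin ne] unfolding M_def by (rule imageE)
  hence a: "a \<in> W" "a \<noteq> 0" by auto
  have beyond: "a $ i = 0" if "i > M" for i
    using that Max_ge[OF supp(1), of i a] leD unfolding M by (fastforce simp: supp_def)
  show ?thesis
  proof (intro bexI[of _ a] conjI ballI allI)
    fix A i assume A: "A \<in> S"
    hence low: "\<And>i j. i < j \<Longrightarrow> A $ i $ j = 0" and diag: "\<And>i j. A $ i $ i = A $ j $ j"
      using S by (auto simp: lower_tri_eq_diag_def)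
    define b where "b = a v* A - A $ i $ i *s a"
    have bW: "b \<in> W"
      unfolding b_def using W inv[OF A a(1)] a(1) by (intro vec.subspace_diff vec.subspace_scale)
    have b0: "b $ j = 0" if "j \<ge> M" for j
    proof -
      \<comment> \<open>Terms with l < j vanish because \<open>A\<close> is lower triangular, those
        with l > j because then l > M. The remaining diagonal term is cancelled by the subtracted
        multiple of \<open>a\<close>.\<close>
      have "(\<Sum>l\<in>UNIV. a $ l * A $ l $ j) = (\<Sum>l\<in>UNIV. if l = j then a $ j * A $ j $ j else 0)"
      proof (rule sum.cong[OF refl])
        fix l show "a $ l * A $ l $ j = (if l = j then a $ j * A $ j $ j else 0)"
          using low[of l j] beyond[of l] that by (cases l j rule: linorder_cases) auto
      qed
      thus ?thesis
        using diag[of i j] by (simp add: b_def vector_matrix_mult_def mult.commute)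
    qed
    have "b = 0"
    proof (rule ccontr)
      assume "b \<noteq> 0"
      hence "Max (supp b) \<in> supp b" using supp by (intro Max_in)
      hence "Max (supp b) < M" using b0[of "Max (supp b)"] not_le by (auto simp: supp_def)
      moreover have "M \<le> Max (supp b)"
        unfolding M_def using bW \<open>b \<noteq> 0\<close> by (intro Min_le fin) auto
      ultimately show False by simp
    qed
    thus "a v* A = A $ i $ i *s a" by (simp add: b_def)
  qed (fact a)+
qed

section \<open>Products of powers of the generators\<close>

text \<open>Kept general in \<open>f\<close> so that it covers both the pairing with a left
  eigenvector and the first coordinate, with literally the same factor.\<close>

lemma power_prod_eigenfunctional:
  assumes "\<And>j x. j \<in> {1..p} \<Longrightarrow> f (A j *v x) = c j * f x"
  shows "f (power_prod A p k *v x) = (\<Prod>j=1..p. c j ^ k j) * f x"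
  using assms
proof (induction p arbitrary: x)
  case (Suc p)
  have pow: "f (mat_power (A (Suc p)) l *v x) = c (Suc p) ^ l * f x" for l
    using Suc.prems by (induction l) (simp_all add: mult.assoc flip: matrix_vector_mul_assoc)
  show ?case
    using Suc.IH[of "mat_power (A (Suc p)) (k (Suc p)) *v x"] Suc.prems
    by (simp add: pow mult.assoc flip: matrix_vector_mul_assoc)
qed simp

lemma commute_power_prod:
  assumes "\<And>j. j \<in> {1..p} \<Longrightarrow> T ** A j = A j ** T"
  shows "T ** power_prod A p k = power_prod A p k ** T"
  using assms
proof (induction p)
  case (Suc p)
  have "T ** A (Suc p) = A (Suc p) ** T" using Suc.prems by simp
  hence pow: "T ** mat_power (A (Suc p)) l = mat_power (A (Suc p)) l ** T" for l
    by (induction l) (simp_all, metis matrix_mul_assoc)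
  have IH: "T ** power_prod A p k = power_prod A p k ** T" using Suc by simp
  show ?case by (simp, metis IH pow matrix_mul_assoc)
qed simp

section \<open>Cyclic vectors for the commutant and density of the orbit\<close>

lemma extended_limit_set_subset_closure_orbit:
  fixes A :: "nat \<Rightarrow> complex ^ 'n ^ 'n"
  assumes cyc: "\<And>x. \<exists>T. (\<forall>j\<in>{1..p}. T ** A j = A j ** T) \<and> T *v u = x"
  shows "extended_limit_set A p u \<subseteq> closure (orbit (generated_semigroup A p) u)"
proof
  fix y assume y: "y \<in> extended_limit_set A p u"
  obtain xs k where xs: "xs \<longlonglongrightarrow> u" and lim: "(\<lambda>m. power_prod A p (k m) *v xs m) \<longlonglongrightarrow> y"
    using y unfolding extended_limit_set_def by blast
  \<comment> \<open>Finitely many \<open>T i\<close>, fixed once, suffice: I + \<Sum>i (xs m - u)_i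
    T_i commutes with the generators, maps \<open>u\<close> to \<open>xs m\<close> and tends to
    I.\<close>
  obtain T where comm: "\<And>i j. j \<in> {1..p} \<Longrightarrow> T i ** A j = A j ** T i"
    and T: "\<And>i. T i *v u = axis i 1"
    using cyc[of "axis _ 1"] by metis
  define w where "w m = power_prod A p (k m) *v xs m" for m
  define z where "z m = power_prod A p (k m) *v u" for m
  define \<epsilon> where "\<epsilon> m = (\<Sum>i\<in>UNIV. norm (xs m $ i - u $ i) * onorm ((*v) (T i)))" for m
  have wz: "w m - z m = (\<Sum>i\<in>UNIV. (xs m $ i - u $ i) *s (T i *v z m))" for m
  proof -
    let ?B = "power_prod A p (k m)"
    have "xs m - u = (\<Sum>i\<in>UNIV. (xs m - u) $ i *s (T i *v u))"
      unfolding T by (rule basis_expansion[symmetric])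
    hence "w m - z m = ?B *v (\<Sum>i\<in>UNIV. (xs m - u) $ i *s (T i *v u))"
      unfolding w_def z_def by (metis matrix_vector_mult_diff_distrib)
    also have "\<dots> = (\<Sum>i\<in>UNIV. (xs m - u) $ i *s (?B *v (T i *v u)))"
      by (simp only: vec.linear_sum[OF matrix_vector_mul_linear_gen] vector_scalar_commute)
    also have "(\<lambda>i. ?B *v (T i *v u)) = (\<lambda>i. T i *v z m)"
      using commute_power_prod[of p "T _" A, OF comm]
      by (simp add: z_def matrix_vector_mul_assoc)
    finally show ?thesis by simp
  qed
  have est: "norm (w m - z m) \<le> \<epsilon> m * norm (z m)" for m
  proof -
    have scale: "norm (c *s v) = norm c * norm v" for c :: complex and v :: "complex ^ 'n"
      by (simp add: norm_vec_def norm_mult L2_set_right_distrib)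
    have "norm (w m - z m) \<le> (\<Sum>i\<in>UNIV. norm (xs m $ i - u $ i) * (onorm ((*v) (T i)) * norm (z m)))"
      unfolding wz by (intro sum_norm_le) (simp add: scale mult_left_mono onorm del: vector_sub_rdistrib)
    thus ?thesis by (simp add: \<epsilon>_def sum_distrib_right mult.assoc)
  qed
  have "\<epsilon> \<longlonglongrightarrow> (\<Sum>i\<in>UNIV. norm (u $ i - u $ i) * onorm ((*v) (T i)))"
    unfolding \<epsilon>_def using xs by (intro tendsto_intros)
  hence \<epsilon>: "\<epsilon> \<longlonglongrightarrow> 0" by simp
  hence "\<forall>\<^sub>F m in sequentially. \<epsilon> m < 1/2" by (rule order_tendstoD) simp
  \<comment> \<open>The bound \<open>est\<close> involves \<open>z\<close>, not yet known to be
    bounded. Once \<epsilon> is below 1/2, the triangle inequality lets the left side absorb half of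
    itself, leaving a bound by the convergent sequence \<open>w\<close>.\<close>
  hence "\<forall>\<^sub>F m in sequentially. norm (w m - z m) \<le> 2 * \<epsilon> m * norm (w m)"
  proof eventually_elim
    case (elim m)
    have "\<epsilon> m \<ge> 0" unfolding \<epsilon>_def by (intro sum_nonneg mult_nonneg_nonneg onorm_pos_le) auto
    have "norm (z m) \<le> norm (w m) + norm (w m - z m)"
      by (metis norm_minus_commute norm_triangle_sub)
    hence "norm (w m - z m) \<le> \<epsilon> m * (norm (w m) + norm (w m - z m))"
      using est[of m] \<open>\<epsilon> m \<ge> 0\<close> by (meson mult_left_mono order_trans)
    also have "\<dots> \<le> \<epsilon> m * norm (w m) + 1/2 * norm (w m - z m)"
      using mult_right_mono[of "\<epsilon> m" "1/2" "norm (w m - z m)"] elim by (simp add: distrib_left)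
    finally show ?case by simp
  qed
  moreover have "(\<lambda>m. 2 * \<epsilon> m * norm (w m)) \<longlonglongrightarrow> 0"
    unfolding w_def by (rule tendsto_eq_intros \<epsilon> lim refl)+ simp
  ultimately have "(\<lambda>m. w m - z m) \<longlonglongrightarrow> 0"
    by (rule Lim_null_comparison)
  hence "(\<lambda>m. w m - (w m - z m)) \<longlonglongrightarrow> y - 0"
    using lim unfolding w_def by (intro tendsto_diff)
  hence "z \<longlonglongrightarrow> y" by simp
  moreover have "z m \<in> orbit (generated_semigroup A p) u" for m
    by (auto simp: z_def orbit_def generated_semigroup_def)
  ultimately show "y \<in> closure (orbit (generated_semigroup A p) u)"
    unfolding closure_sequential by blast
qed

text \<open>Supplies the hypothesis \<open>cyc\<close> of
  \<open>extended_limit_set_subset_closure_orbit\<close>.\<close>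

lemma cyclic_for_commutant:
  fixes A :: "nat \<Rightarrow> ((complex, 'n::{finite,linorder}) vec, 'n) vec"
  assumes tri: "\<And>j. j \<in> {1..p} \<Longrightarrow> A j \<in> lower_tri_eq_diag"
    and comm: "\<And>i j. i \<in> {1..p} \<Longrightarrow> j \<in> {1..p} \<Longrightarrow> A i ** A j = A j ** A i"
    and u: "u $ Min UNIV \<noteq> 0"
    and J: "extended_limit_set A p u = UNIV"
  shows "\<exists>T. (\<forall>j\<in>{1..p}. T ** A j = A j ** T) \<and> T *v u = x"
proof -
  define i0 :: 'n where "i0 = Min UNIV"
  define E where "E = {T *v u |T. \<forall>j\<in>{1..p}. T ** A j = A j ** T}"
  have "E = UNIV"
  proof (rule ccontr)
    assume proper: "E \<noteq> UNIV"
    have add_rdistrib: "(S + T) ** B = S ** B + T ** B" for S T B :: "((complex, 'n) vec, 'n) vec"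
      by (simp add: matrix_matrix_mult_def vec_eq_iff distrib_right sum.distrib)
    have subE: "vec.subspace E"
    proof (rule vec.subspaceI)
      show "0 \<in> E" unfolding E_def by (rule CollectI, rule exI[of _ 0]) simp
    next
      fix x y assume "x \<in> E" "y \<in> E"
      then obtain S T where "x = S *v u" "y = T *v u"
        "\<forall>j\<in>{1..p}. S ** A j = A j ** S" "\<forall>j\<in>{1..p}. T ** A j = A j ** T"
        unfolding E_def by blast
      thus "x + y \<in> E" unfolding E_def
        by (intro CollectI exI[of _ "S + T"])
          (simp add: matrix_vector_mult_add_rdistrib matrix_add_ldistrib add_rdistrib)
    next
      fix c x assume "x \<in> E"
      then obtain T where x: "x = T *v u" and T: "\<forall>j\<in>{1..p}. T ** A j = A j ** T"
        unfolding E_def by blast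
      \<comment> \<open>The complex multiple of \<open>T\<close>, built row by row because
        \<open>*s\<close> applied to the matrix itself would take a whole row as scalar.\<close>
      define cT where "cT = (\<chi> i. c *s T $ i)"
      have "cT *v u = c *s x"
        by (simp add: x cT_def vec_eq_iff matrix_vector_mult_def sum_distrib_left mult.assoc)
      moreover have "cT ** B = (\<chi> i. c *s (T ** B) $ i)" "B ** cT = (\<chi> i. c *s (B ** T) $ i)" for B
        by (simp_all add: cT_def vec_eq_iff matrix_matrix_mult_def sum_distrib_left mult_ac)
      ultimately show "c *s x \<in> E" unfolding E_def using T
        by (intro CollectI exI[of _ cT]) simp
    qed
    \<comment> \<open>The generators commute with each other, so multiplying by one of them stays
      inside the commutant.\<close>
    have invE: "A j *v x \<in> E" if j: "j \<in> {1..p}" and "x \<in> E" for j x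
    proof -
      obtain T where x: "x = T *v u" and T: "\<forall>j\<in>{1..p}. T ** A j = A j ** T"
        using \<open>x \<in> E\<close> unfolding E_def by blast
      have "\<forall>i\<in>{1..p}. (A j ** T) ** A i = A i ** (A j ** T)"
        using T comm[OF j] by (metis matrix_mul_assoc)
      thus ?thesis unfolding E_def x by (auto simp: matrix_vector_mul_assoc)
    qed
    \<comment> \<open>Invariance of \<open>E\<close> under the matrices passes to invariance of its
      annihilator under their action on rows.\<close>
    define W where "W = {a. \<forall>x\<in>E. bilin_dot a x = 0}"
    have "vec.subspace W"
      by (rule vec.subspaceI) (auto simp: W_def bilin_dot_def distrib_right sum.distrib
          sum_distrib_left[symmetric] mult.assoc)
    moreover have "W \<noteq> {0}"
      using proper_subspace_annihilator[OF subE proper] unfolding W_def by blast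
    moreover have "A ` {1..p} \<subseteq> lower_tri_eq_diag" using tri by blast
    moreover have "a v* B \<in> W" if "B \<in> A ` {1..p}" "a \<in> W" for B a
      using that invE by (auto simp: W_def simp flip: bilin_dot_matrix)
    ultimately have "\<exists>a\<in>W. a \<noteq> 0 \<and> (\<forall>B\<in>A ` {1..p}. \<forall>i. a v* B = B $ i $ i *s a)"
      by (rule common_left_eigenvector)
    then obtain a where a: "a \<in> W" "a \<noteq> 0"
      and eig: "\<And>j i. j \<in> {1..p} \<Longrightarrow> a v* A j = A j $ i $ i *s a"
      by blast
    define c where "c j = A j $ i0 $ i0" for j
    have fa: "bilin_dot a (power_prod A p k *v x) = (\<Prod>j=1..p. c j ^ k j) * bilin_dot a x" for k x
      by (rule power_prod_eigenfunctional[where f = "bilin_dot a"])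
        (simp add: bilin_dot_matrix eig[of _ i0] bilin_dot_scale c_def)
    \<comment> \<open>The top row of a lower triangular matrix has only its diagonal entry, so the
      first coordinate is an eigenfunctional as well.\<close>
    have f0: "(power_prod A p k *v x) $ i0 = (\<Prod>j=1..p. c j ^ k j) * x $ i0" for k x
    proof (rule power_prod_eigenfunctional[where f = "\<lambda>x. x $ i0"])
      fix j x assume "j \<in> {1..p}"
      hence low: "A j $ i0 $ l = 0" if "l \<noteq> i0" for l
        using tri[of j] that Min_le[of UNIV l] unfolding lower_tri_eq_diag_def i0_def
        by (auto simp: less_le)
      have "(\<Sum>l\<in>UNIV. A j $ i0 $ l * x $ l) = (\<Sum>l\<in>UNIV. if l = i0 then c j * x $ i0 else 0)"
        by (intro sum.cong) (auto simp: low c_def)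
      thus "(A j *v x) $ i0 = c j * x $ i0" by (simp add: matrix_vector_mult_def)
    qed
    have "u \<in> E" unfolding E_def by (rule CollectI, rule exI[of _ "mat 1"]) simp
    hence au: "bilin_dot a u = 0" using a(1) by (simp add: W_def)
    have "bilin_dot a y = 0" for y
    proof -
      obtain xs k where xs: "xs \<longlonglongrightarrow> u" and lim: "(\<lambda>m. power_prod A p (k m) *v xs m) \<longlonglongrightarrow> y"
        using J unfolding extended_limit_set_def by blast
      \<comment> \<open>Cross-multiplying avoids both a division and a separate limit for the
        eigenvalues: by \<open>fa\<close> and \<open>f0\<close> the two sequences coincide, hence so
        do their limits.\<close>
      have "(\<lambda>m. (power_prod A p (k m) *v xs m) $ i0 * bilin_dot a (xs m))
          \<longlonglongrightarrow> y $ i0 * bilin_dot a u"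
        by (intro tendsto_intros lim xs tendsto_bilin_dot)
      moreover have "(\<lambda>m. bilin_dot a (power_prod A p (k m) *v xs m) * xs m $ i0)
          \<longlonglongrightarrow> bilin_dot a y * u $ i0"
        by (intro tendsto_intros lim xs tendsto_bilin_dot)
      ultimately have "y $ i0 * bilin_dot a u = bilin_dot a y * u $ i0"
        by (intro LIMSEQ_unique) (simp_all add: fa f0 mult_ac)
      thus ?thesis using u au by (simp add: i0_def)
    qed
    with a(2) bilin_dot_nondegenerate show False by blast
  qed
  hence "x \<in> E" by simp
  thus ?thesis unfolding E_def by blast
qed

theorem proposition1p6:
  fixes A :: "nat \<Rightarrow> ((complex, 'n::{finite,linorder}) vec, 'n) vec"
    and p :: nat
  assumes "p \<ge> 1"
    and "\<And>j. j \<in> {1..p} \<Longrightarrow> A j \<in> lower_tri_eq_diag"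
    and "\<And>i j. i \<in> {1..p} \<Longrightarrow> j \<in> {1..p} \<Longrightarrow> A i ** A j = A j ** A i"
    and "\<exists>e :: 'n \<Rightarrow> (complex, 'n) vec.
           complex_basis e \<and> (\<forall>k. extended_limit_set A p (e k) = UNIV)"
  shows "hypercyclic (generated_semigroup A p)"
proof -
  obtain e :: "'n \<Rightarrow> (complex, 'n) vec" where e: "vec.span (range e) = UNIV"
    and J: "\<And>k. extended_limit_set A p (e k) = UNIV"
    using assms(4) unfolding complex_basis_def by blast
  \<comment> \<open>A spanning family cannot lie in this proper coordinate hyperplane.\<close>
  define H where "H = {x :: (complex, 'n) vec. x $ Min UNIV = 0}"
  have "vec.subspace H" by (rule vec.subspaceI) (auto simp: H_def)
  moreover have "axis (Min UNIV) 1 \<notin> H" by (simp add: H_def)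
  ultimately have "\<not> range e \<subseteq> H" using vec.span_minimal[of "range e" H] e by blast
  then obtain k where k: "e k $ Min UNIV \<noteq> 0" unfolding H_def by blast
  have "closure (orbit (generated_semigroup A p) (e k)) = UNIV"
    using extended_limit_set_subset_closure_orbit[OF cyclic_for_commutant[OF assms(2,3) k J]] J[of k]
    by (simp add: top.extremum_unique)
  thus ?thesis unfolding hypercyclic_def by blast
qed

end
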